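(* Let $n\ge 3$, let $F\subseteq E(K_n)$ be a set of $p\ge 1$ edges of the complete graph $K_n$, and assume that $K_n-F$ is connected. Let $Q$ be the edge-defect matrix of $F$, with eigenvalues $\theta_1,\ldots,\theta_p$ (with multiplicity, including zero eigenvalues). Then $$Kf(K_n-F)=n-1+\frac{2p}{n-2}+\frac{n}{(n-2)^2}\operatorname{tr}\left((Q-2I_p)^2(nI_p-Q)^{-1}\right).$$ Equivalently, $$Kf(K_n-F)=n-1+\frac{2p}{n-2}+\frac{n}{(n-2)^2}\sum_{\alpha=1}^{p}\frac{(\theta_\alpha-2)^2}{n-\theta_\alpha}.$$
   Context: $K_n-F$ is the graph on the vertices of $K_n$ obtained by deleting the edges in $F=\{e_1,\ldots,e_p\}$. For each deleted edge $e_\alpha=\{u_\alpha,v_\alpha\}$ choose an arbitrary orientation and put $b_\alpha=e_{u_\alpha}-e_{v_\alpha}\in\mathbb{R}^n$, where $e_x$ is the standard basis vector of vertex $x$; put $B=[\,b_1\ \cdots\ b_p\,]$ (an $n\times p$ matrix). The edge-defect matrix of $F$ is the $p\times p$ matrix $Q=B^TB$. For a connected graph $G$ with Laplacian $L(G)=D(G)-A(G)$, the effective resistance between distinct vertices is $R_G(x,y)=(e_x-e_y)^TL(G)^+(e_x-e_y)$ ($L(G)^+$ the Moore--Penrose inverse), and the Kirchhoff index is $Kf(G)=\sum_{\{x,y\}}R_G(x,y)$, the sum over all unordered pairs of distinct vertices. *)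

theory Defs
  imports
    "Jordan_Normal_Form.Char_Poly"
    "Jordan_Normal_Form.Gauss_Jordan_Elimination"
begin

text \<open>A graph on \<open>n\<close> vertices has vertex set \<open>{..<n}\<close> and is given by its set of edges, each
  edge being a two-element set of vertices.\<close>

definition complete_edges :: "nat \<Rightarrow> nat set set" where
  "complete_edges n = {{x, y} | x y. x < n \<and> y < n \<and> x \<noteq> y}"

definition graph_connected :: "nat \<Rightarrow> nat set set \<Rightarrow> bool" where
  "graph_connected n E \<longleftrightarrow> (\<forall>x<n. \<forall>y<n. (x, y) \<in> {(a, b). {a, b} \<in> E}\<^sup>*)"

definition degree_mat :: "nat \<Rightarrow> nat set set \<Rightarrow> real mat" where
  "degree_mat n E = mat n n (\<lambda>(x, y). if x = y then real (card {e \<in> E. x \<in> e}) else 0)"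

definition adjacency_mat :: "nat \<Rightarrow> nat set set \<Rightarrow> real mat" where
  "adjacency_mat n E = mat n n (\<lambda>(x, y). if x \<noteq> y \<and> {x, y} \<in> E then 1 else 0)"

definition laplacian :: "nat \<Rightarrow> nat set set \<Rightarrow> real mat" where
  "laplacian n E = degree_mat n E - adjacency_mat n E"

text \<open>The four Penrose conditions; a real matrix has exactly one such \<open>X\<close>.\<close>

definition is_pseudoinverse :: "real mat \<Rightarrow> real mat \<Rightarrow> bool" where
  "is_pseudoinverse A X \<longleftrightarrow>
     X \<in> carrier_mat (dim_col A) (dim_row A) \<and>
     A * X * A = A \<and> X * A * X = X \<and>
     transpose_mat (A * X) = A * X \<and> transpose_mat (X * A) = X * A"

definition pseudoinverse :: "real mat \<Rightarrow> real mat" where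
  "pseudoinverse A = (THE X. is_pseudoinverse A X)"

definition effective_resistance :: "nat \<Rightarrow> nat set set \<Rightarrow> nat \<Rightarrow> nat \<Rightarrow> real" where
  "effective_resistance n E x y =
     (unit_vec n x - unit_vec n y) \<bullet>
       (pseudoinverse (laplacian n E) *\<^sub>v (unit_vec n x - unit_vec n y))"

text \<open>Each unordered pair of distinct vertices is represented by the pair \<open>(x, y)\<close> with \<open>x < y\<close>.\<close>

definition kirchhoff_index :: "nat \<Rightarrow> nat set set \<Rightarrow> real" where
  "kirchhoff_index n E = (\<Sum>(x, y) | x < y \<and> y < n. effective_resistance n E x y)"

text \<open>The functions \<open>u\<close> and \<open>v\<close> enumerate and orient the deleted edges: for \<open>\<alpha> < p\<close> the edge
  \<open>e\<^sub>\<alpha> = {u \<alpha>, v \<alpha>}\<close> gives the column \<open>b\<^sub>\<alpha>\<close>.\<close>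

definition oriented_incidence_mat :: "nat \<Rightarrow> nat \<Rightarrow> (nat \<Rightarrow> nat) \<Rightarrow> (nat \<Rightarrow> nat) \<Rightarrow> real mat" where
  "oriented_incidence_mat n p u v =
     mat_of_cols n (map (\<lambda>\<alpha>. unit_vec n (u \<alpha>) - unit_vec n (v \<alpha>)) [0..<p])"

definition edge_defect_mat :: "nat \<Rightarrow> nat \<Rightarrow> (nat \<Rightarrow> nat) \<Rightarrow> (nat \<Rightarrow> nat) \<Rightarrow> real mat" where
  "edge_defect_mat n p u v =
     transpose_mat (oriented_incidence_mat n p u v) * oriented_incidence_mat n p u v"

definition trace_mat :: "real mat \<Rightarrow> real" where
  "trace_mat A = sum_list (diag_mat A)"

text \<open>\<open>mat_inverse\<close> returns an option; on invertible matrices it is \<open>Some\<close> of the inverse.\<close>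

definition inv_mat :: "real mat \<Rightarrow> real mat" where
  "inv_mat A = the (mat_inverse A)"

text \<open>\<open>\<theta> 0, \<dots>, \<theta> (m - 1)\<close> are the eigenvalues of the \<open>m \<times> m\<close> matrix \<open>A\<close>, listed with
  (algebraic) multiplicity.\<close>

definition eigenvalues_of :: "real mat \<Rightarrow> (nat \<Rightarrow> real) \<Rightarrow> bool" where
  "eigenvalues_of A \<theta> \<longleftrightarrow> char_poly A = (\<Prod>\<alpha><dim_row A. [:- \<theta> \<alpha>, 1:])"

text \<open>Real symmetric matrices, in particular edge-defect matrices, do have such a list of real
  eigenvalues.\<close>

lemma eigenvalues_of_exists:
  assumes A: "A \<in> carrier_mat m m" and sym: "transpose_mat A = A"
  shows "\<exists>\<theta>. eigenvalues_of A \<theta>"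
proof -
  let ?C = "map_mat complex_of_real A"
  have C: "?C \<in> carrier_mat m m" using A by simp
  obtain as where as: "char_poly ?C = (\<Prod>a\<leftarrow>as. [:- a, 1:])" and len: "length as = m"
    using char_poly_factorized[OF C] by blast
  have real: "a \<in> \<real>" if "a \<in> set as" for a
  proof -
    have "poly (char_poly ?C) a = 0"
      unfolding as poly_prod_list using that by (auto simp: prod_list_zero_iff image_iff)
    then obtain w where w: "w \<in> carrier_vec m" "w \<noteq> 0\<^sub>v m" and ev: "?C *\<^sub>v w = a \<cdot>\<^sub>v w"
      using eigenvalue_root_char_poly[OF C] A unfolding eigenvalue_def eigenvector_def by auto
    have cw: "conjugate w \<in> carrier_vec m" using w by simp
    have entry: "A $$ (i, j) = A $$ (j, i)" if "i < m" "j < m" for i j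
      using sym A that by (metis carrier_matD index_transpose_mat(1))
    have Cw: "(\<Sum>j<m. complex_of_real (A $$ (i, j)) * w $ j) = a * w $ i" if "i < m" for i
    proof -
      have "(?C *\<^sub>v w) $ i = (\<Sum>j<m. complex_of_real (A $$ (i, j)) * w $ j)"
        using that A w by (auto simp: scalar_prod_def lessThan_atLeast0 intro!: sum.cong)
      then show ?thesis using ev w that by simp
    qed
    define S where "S = (\<Sum>i<m. cnj (w $ i) * w $ i)"
    define T where "T = (\<Sum>i<m. \<Sum>j<m. cnj (w $ i) * complex_of_real (A $$ (i, j)) * w $ j)"
    have T: "T = a * S"
    proof -
      have "T = (\<Sum>i<m. cnj (w $ i) * (\<Sum>j<m. complex_of_real (A $$ (i, j)) * w $ j))"
        unfolding T_def by (simp add: sum_distrib_left mult.assoc)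
      also have "\<dots> = a * S" unfolding S_def using Cw by (simp add: sum_distrib_left mult_ac)
      finally show ?thesis .
    qed
    have "cnj T = (\<Sum>i<m. \<Sum>j<m. cnj (w $ j) * complex_of_real (A $$ (j, i)) * w $ i)"
      unfolding T_def cnj_sum by (intro sum.cong refl) (auto simp: mult_ac entry)
    also have "\<dots> = T" unfolding T_def by (rule sum.swap)
    finally have cT: "cnj T = T" .
    have cS: "cnj S = S" unfolding S_def by (simp add: mult.commute)
    obtain k where k: "k < m" "w $ k \<noteq> 0" using w by (metis carrier_vecD eq_vecI index_zero_vec)
    have "S = complex_of_real (\<Sum>i<m. (cmod (w $ i))\<^sup>2)"
      unfolding S_def of_real_sum
      by (intro sum.cong refl) (simp only: complex_norm_square[symmetric] mult.commute)
    moreover have "(\<Sum>i<m. (cmod (w $ i))\<^sup>2) > 0"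
      by (rule sum_pos2[of _ k]) (use k in auto)
    ultimately have "S \<noteq> 0" by (metis of_real_eq_0_iff less_irrefl)
    with T cT cS have "cnj a = a" by (metis complex_cnj_mult mult_right_cancel)
    then show ?thesis by (simp add: Reals_cnj_iff)
  qed
  define \<theta> where "\<theta> i = Re (as ! i)" for i
  have "map_poly complex_of_real (char_poly A) = char_poly ?C"
    by (rule of_real_hom.char_poly_hom[OF A, symmetric])
  also have "\<dots> = (\<Prod>\<alpha><m. [:- (as ! \<alpha>), 1:])"
    unfolding as using len by (simp add: prod.list_conv_set_nth lessThan_atLeast0)
  also have "\<dots> = (\<Prod>\<alpha><m. map_poly complex_of_real [:- \<theta> \<alpha>, 1:])"
    by (intro prod.cong refl) (use real len in \<open>auto simp: \<theta>_def of_real_Re\<close>)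
  also have "\<dots> = map_poly complex_of_real (\<Prod>\<alpha><m. [:- \<theta> \<alpha>, 1:])"
  proof -
    interpret h: map_poly_comm_ring_hom complex_of_real ..
    show ?thesis by (rule h.hom_prod[symmetric])
  qed
  finally have "char_poly A = (\<Prod>\<alpha><m. [:- \<theta> \<alpha>, 1:])"
    by (simp add: poly_eq_iff coeff_map_poly)
  then show ?thesis using A unfolding eigenvalues_of_def by auto
qed

end

theory Submission
  imports Defs "Jordan_Normal_Form.Schur_Decomposition"
begin

text \<open>Let \<open>J\<close> be the all-ones matrix and \<open>M = n I - B B\<^sup>T\<close>, so that \<open>K\<^sub>n - F\<close> has Laplacian \<open>L = M - J\<close>.
  Connectedness makes \<open>M\<close> invertible, hence also \<open>N = n I - Q\<close>, because \<open>M B = B N\<close>. As \<open>M J = n J\<close>, the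
  pseudoinverse of \<open>L\<close> is \<open>M\<^sup>-\<^sup>1 - J / n\<^sup>2\<close>, and by Woodbury \<open>M\<^sup>-\<^sup>1 = (I + B N\<^sup>-\<^sup>1 B\<^sup>T) / n\<close>. Since
  \<open>Kf = n tr L\<^sup>+\<close>, this gives \<open>Kf = n - 1 - p + n tr N\<^sup>-\<^sup>1\<close>. The stated form follows from
  \<open>Q - 2 I = (n - 2) I - N\<close> and \<open>tr Q = 2 p\<close>. Triangularising \<open>Q\<close> expresses \<open>tr N\<^sup>-\<^sup>1\<close> through the
  eigenvalues.\<close>

section \<open>Traces and inverses of square matrices\<close>

lemma trace_mat_eq_sum:
  assumes "A \<in> carrier_mat m m"
  shows "trace_mat A = (\<Sum>i<m. A $$ (i, i))"
  using assms unfolding trace_mat_def diag_mat_def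
  by (simp add: sum_list_distinct_conv_sum_set lessThan_atLeast0)

lemma trace_mat_mult_comm:
  assumes "A \<in> carrier_mat m k" "B \<in> carrier_mat k m"
  shows "trace_mat (A * B) = trace_mat (B * A)"
proof -
  have "trace_mat (A * B) = (\<Sum>i<m. \<Sum>j<k. A $$ (i, j) * B $$ (j, i))"
    using assms by (simp add: trace_mat_eq_sum[of _ m] scalar_prod_def lessThan_atLeast0)
  also have "\<dots> = (\<Sum>j<k. \<Sum>i<m. B $$ (j, i) * A $$ (i, j))"
    by (subst sum.swap) (simp add: mult.commute)
  also have "\<dots> = trace_mat (B * A)"
    using assms by (simp add: trace_mat_eq_sum[of _ k] scalar_prod_def lessThan_atLeast0)
  finally show ?thesis .
qed

lemma trace_mat_add:
  assumes "A \<in> carrier_mat m m" "B \<in> carrier_mat m m"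
  shows "trace_mat (A + B) = trace_mat A + trace_mat B"
  using assms by (simp add: trace_mat_eq_sum[of _ m] sum.distrib)

lemma trace_mat_minus:
  assumes "A \<in> carrier_mat m m" "B \<in> carrier_mat m m"
  shows "trace_mat (A - B) = trace_mat A - trace_mat B"
  using assms minus_carrier_mat[of B m m A] by (simp add: trace_mat_eq_sum[of _ m] sum_subtractf)

lemma trace_mat_smult:
  assumes "A \<in> carrier_mat m m"
  shows "trace_mat (c \<cdot>\<^sub>m A) = c * trace_mat A"
  using assms by (simp add: trace_mat_eq_sum[of _ m] sum_distrib_left)

lemma trace_mat_one: "trace_mat (1\<^sub>m m) = real m"
  by (simp add: trace_mat_eq_sum[of _ m])

lemma trace_mat_conj:
  assumes "T \<in> carrier_mat m m" "P \<in> carrier_mat m m" "R \<in> carrier_mat m m" "R * P = 1\<^sub>m m"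
  shows "trace_mat (P * T * R) = trace_mat T"
proof -
  have "trace_mat (P * T * R) = trace_mat (R * (P * T))"
    using assms by (intro trace_mat_mult_comm[of _ m m]) auto
  also have "R * (P * T) = R * P * T"
    using assms by (intro assoc_mult_mat[symmetric]) auto
  finally show ?thesis using assms by simp
qed

text \<open>A trivial kernel gives a nonzero determinant, so \<open>A\<close> is a unit of the
  matrix ring and \<open>mat_inverse\<close> cannot return \<open>None\<close>.\<close>

lemma inv_mat_of_trivial_kernel:
  assumes A: "A \<in> carrier_mat m m"
    and ker: "\<And>x. x \<in> carrier_vec m \<Longrightarrow> A *\<^sub>v x = 0\<^sub>v m \<Longrightarrow> x = 0\<^sub>v m"
  shows "inv_mat A \<in> carrier_mat m m" "A * inv_mat A = 1\<^sub>m m" "inv_mat A * A = 1\<^sub>m m"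
proof -
  have "det A \<noteq> 0" using ker det_0_iff_vec_prod_zero_field[OF A] by blast
  from det_non_zero_imp_unit[OF A this, of "()"] mat_inverse(1)[OF A, of "()"]
  obtain X where "mat_inverse A = Some X" by (cases "mat_inverse A") auto
  then show "inv_mat A \<in> carrier_mat m m" "A * inv_mat A = 1\<^sub>m m" "inv_mat A * A = 1\<^sub>m m"
    using mat_inverse(2)[OF A] by (simp_all add: inv_mat_def)
qed

section \<open>Triangularisation and eigenvalues\<close>

text \<open>Back substitution in column \<open>j\<close> of \<open>T * S = 1\<close>: from the
  bottom row upwards the entries of \<open>S\<close> below the diagonal vanish one after another,
  and then row \<open>j\<close> retains only the diagonal product.\<close>

lemma diag_inverse_upper_triangular:
  fixes T S :: "'a :: field mat"
  assumes T: "T \<in> carrier_mat m m" and S: "S \<in> carrier_mat m m"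
    and upper: "upper_triangular T" and inv: "T * S = 1\<^sub>m m" and j: "j < m"
  shows "T $$ (j, j) * S $$ (j, j) = 1"
proof -
  have entry: "(\<Sum>k<m. T $$ (i, k) * S $$ (k, j)) = (if i = j then 1 else 0)" if "i < m" for i
  proof -
    have "(T * S) $$ (i, j) = (\<Sum>k<m. T $$ (i, k) * S $$ (k, j))"
      using T S that j by (simp add: scalar_prod_def lessThan_atLeast0)
    then show ?thesis using inv that j by simp
  qed
  have nz: "T $$ (i, i) \<noteq> 0" if "i < m" for i
  proof -
    have "det T * det S = 1" using det_mult[OF T S] inv by simp
    then have "det T \<noteq> 0" by auto
    then show ?thesis
      using det_upper_triangular[OF upper T] T that
      by (auto simp: prod_list_zero_iff diag_mat_def)
  qed
  \<comment> \<open>\<open>T\<close> vanishes left of its diagonal and column \<open>j\<close> of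
    \<open>S\<close> is assumed to vanish below row \<open>i\<close>, so only the summand
    \<open>k = i\<close> survives.\<close>
  have row: "T $$ (i, i) * S $$ (i, j) = (if i = j then 1 else 0)"
    if i: "i < m" and below: "\<And>k. i < k \<Longrightarrow> k < m \<Longrightarrow> S $$ (k, j) = 0" for i
  proof -
    have "T $$ (i, k) * S $$ (k, j) = 0" if "k < m" "k \<noteq> i" for k
      using that i below[of k] upper T by (cases "k < i") (auto simp: upper_triangular_def)
    then have "(\<Sum>k<m. T $$ (i, k) * S $$ (k, j)) = (\<Sum>k\<in>{i}. T $$ (i, k) * S $$ (k, j))"
      using i by (intro sum.mono_neutral_right) auto
    then show ?thesis using entry[OF i] by simp
  qed
  \<comment> \<open>The measure \<open>m - i\<close> lets the induction start at the last
    row.\<close>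
  have below: "S $$ (i, j) = 0" if "i < m" "j < i" for i
    using that
  proof (induction "m - i" arbitrary: i rule: less_induct)
    case less
    have "T $$ (i, i) * S $$ (i, j) = (if i = j then 1 else 0)"
      using less.prems by (intro row less.hyps) auto
    then show ?case using less.prems nz[of i] by auto
  qed
  show ?thesis using row[OF j] below by simp
qed

text \<open>A Schur decomposition puts the listed eigenvalues on the diagonal of a triangular
  \<open>T\<close>. In the same basis \<open>W\<close> becomes the inverse of
  \<open>c I - T\<close>, whose diagonal consists of reciprocals, and conjugation preserves
  traces.\<close>

lemma eigenvalues_of_trace:
  assumes A: "A \<in> carrier_mat m m" and \<theta>: "eigenvalues_of A \<theta>"
    and W: "W \<in> carrier_mat m m" and inv: "(c \<cdot>\<^sub>m 1\<^sub>m m - A) * W = 1\<^sub>m m"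
  shows "trace_mat A = (\<Sum>\<alpha><m. \<theta> \<alpha>)"
    and "\<And>\<alpha>. \<alpha> < m \<Longrightarrow> \<theta> \<alpha> \<noteq> c"
    and "trace_mat W = (\<Sum>\<alpha><m. 1 / (c - \<theta> \<alpha>))"
proof -
  \<comment> \<open>\<open>schur_decomposition\<close> takes the roots as a list and keeps their
    order on the diagonal of \<open>T\<close>.\<close>
  have "char_poly A = (\<Prod>e\<leftarrow>map \<theta> [0..<m]. [:- e, 1:])"
    using \<theta> A unfolding eigenvalues_of_def
    by (simp add: prod.distinct_set_conv_list[symmetric] lessThan_atLeast0 comp_def)
  moreover obtain T P R where "schur_decomposition A (map \<theta> [0..<m]) = (T, P, R)"
    by (cases "schur_decomposition A (map \<theta> [0..<m])") auto
  ultimately have sim: "similar_mat_wit A T P R" and upper: "upper_triangular T"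
    and diag: "diag_mat T = map \<theta> [0..<m]"
    using schur_decomposition[OF A] by blast+
  from similar_mat_witD2[OF A sim] have PR: "P * R = 1\<^sub>m m" and RP: "R * P = 1\<^sub>m m"
    and A_eq: "A = P * T * R" and T: "T \<in> carrier_mat m m"
    and P: "P \<in> carrier_mat m m" and R: "R \<in> carrier_mat m m" by auto
  have diagT: "T $$ (i, i) = \<theta> i" if "i < m" for i
  proof -
    have "diag_mat T ! i = map \<theta> [0..<m] ! i" by (simp add: diag)
    then show ?thesis using that T by (simp add: diag_mat_def)
  qed
  show "trace_mat A = (\<Sum>\<alpha><m. \<theta> \<alpha>)"
    using trace_mat_conj[OF T P R RP] trace_mat_eq_sum[OF T] diagT by (simp add: A_eq)
  define S where "S = R * W * P"
  have S: "S \<in> carrier_mat m m" using R W P by (auto simp: S_def)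
  note carr = A T P R W
  note [simp] = assoc_mult_mat[of _ m m _ m _ m] mult_carrier_mat[of _ m m _ m]
  let ?cT = "c \<cdot>\<^sub>m 1\<^sub>m m - T"
  have cT: "?cT \<in> carrier_mat m m" using T by auto
  \<comment> \<open>Conjugation fixes the scalar matrix and turns \<open>A\<close> into
    \<open>T\<close>.\<close>
  have "R * (c \<cdot>\<^sub>m 1\<^sub>m m - A) * P = R * (c \<cdot>\<^sub>m 1\<^sub>m m) * P - R * A * P"
    using carr by (subst mult_minus_distrib_mat[of _ m m _ m], auto)
      (subst minus_mult_distrib_mat[of _ m m], auto)
  also have "R * (c \<cdot>\<^sub>m 1\<^sub>m m) * P = c \<cdot>\<^sub>m (R * P)"
    using carr by (simp add: mult_smult_distrib[of _ m m] mult_smult_assoc_mat[of _ m m])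
  also have "R * A * P = (R * P) * T * (R * P)"
    unfolding A_eq using carr by simp
  finally have conj: "R * (c \<cdot>\<^sub>m 1\<^sub>m m - A) * P = ?cT" using RP T by simp
  have "?cT * S = R * (c \<cdot>\<^sub>m 1\<^sub>m m - A) * (P * R) * W * P"
    unfolding conj[symmetric] S_def using carr minus_carrier_mat[OF A] by simp
  also have "\<dots> = R * ((c \<cdot>\<^sub>m 1\<^sub>m m - A) * W) * P"
    using carr minus_carrier_mat[OF A] by (simp add: PR)
  finally have cTS: "?cT * S = 1\<^sub>m m" using inv RP R by simp
  have "upper_triangular ?cT"
    using upper T by (auto simp: upper_triangular_def)
  note prod = diag_inverse_upper_triangular[OF cT S this cTS]
  have d: "(c - \<theta> i) * S $$ (i, i) = 1" if "i < m" for i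
    using prod[OF that] that T diagT[OF that] by simp
  \<comment> \<open>A product equal to 1 has no zero factor, so \<open>c\<close> is not an
    eigenvalue.\<close>
  then show "\<theta> \<alpha> \<noteq> c" if "\<alpha> < m" for \<alpha> using that by fastforce
  have "trace_mat W = trace_mat S"
    unfolding S_def using trace_mat_conj[OF W R P PR] by simp
  also have "\<dots> = (\<Sum>\<alpha><m. 1 / (c - \<theta> \<alpha>))"
    unfolding trace_mat_eq_sum[OF S]
  proof (intro sum.cong refl)
    fix \<alpha> assume "\<alpha> \<in> {..<m}"
    then show "S $$ (\<alpha>, \<alpha>) = 1 / (c - \<theta> \<alpha>)"
      using d[of \<alpha>] by (auto simp: eq_divide_eq mult.commute)
  qed
  finally show "trace_mat W = (\<Sum>\<alpha><m. 1 / (c - \<theta> \<alpha>))" .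
qed

section \<open>The Moore-Penrose inverse\<close>

text \<open>Penrose's argument: transposing a product of two symmetric projections swaps them, which
  gives \<open>A * X = A * Y\<close> and \<open>X * A = Y * A\<close>; then
  \<open>X = X * A * X = Y * A * Y = Y\<close>. This is what evaluates the definite description in
  \<open>pseudoinverse\<close>.\<close>

lemma is_pseudoinverse_unique:
  assumes "is_pseudoinverse A X" "is_pseudoinverse A Y"
  shows "X = Y"
proof -
  define r c where "r = dim_row A" "c = dim_col A"
  have A: "A \<in> carrier_mat r c" by (auto simp: r_c_def)
  have X: "X \<in> carrier_mat c r" "A * X * A = A" "X * A * X = X"
      "transpose_mat (A * X) = A * X" "transpose_mat (X * A) = X * A"
    and Y: "Y \<in> carrier_mat c r" "A * Y * A = A" "Y * A * Y = Y"
      "transpose_mat (A * Y) = A * Y" "transpose_mat (Y * A) = Y * A"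
    using assms by (auto simp: is_pseudoinverse_def r_c_def)
  have AX: "A * X \<in> carrier_mat r r" and AY: "A * Y \<in> carrier_mat r r"
    and XA: "X * A \<in> carrier_mat c c" and YA: "Y * A \<in> carrier_mat c c"
    using A X(1) Y(1) by auto
  have "A * X = A * Y * A * X" by (simp add: Y(2))
  also have "\<dots> = (A * Y) * (A * X)" by (rule assoc_mult_mat[OF AY A X(1)])
  also have "\<dots> = transpose_mat ((A * X) * (A * Y))"
    by (simp add: transpose_mult[OF AX AY] X(4) Y(4))
  also have "(A * X) * (A * Y) = A * X * A * Y" by (rule assoc_mult_mat[OF AX A Y(1), symmetric])
  finally have 1: "A * X = A * Y" by (simp add: X(2) Y(4))
  have "X * A = X * (A * Y * A)" by (simp add: Y(2))
  also have "\<dots> = (X * A) * (Y * A)"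
    using A X(1) Y(1) by (simp add: assoc_mult_mat[of _ c r _ c _ c] assoc_mult_mat[of _ r c _ r _ c] assoc_mult_mat[OF A Y(1) A])
  also have "\<dots> = transpose_mat ((Y * A) * (X * A))"
    by (simp add: transpose_mult[OF YA XA] X(5) Y(5))
  also have "(Y * A) * (X * A) = Y * (A * X * A)"
    using A X(1) Y(1) by (simp add: assoc_mult_mat[of _ c r _ c _ c] assoc_mult_mat[of _ r c _ r _ c] assoc_mult_mat[OF A X(1) A])
  finally have 2: "X * A = Y * A" by (simp add: X(2) Y(5))
  have "X = X * A * X" by (simp add: X(3))
  also have "\<dots> = Y * (A * X)" unfolding 2 by (rule assoc_mult_mat[OF Y(1) A X(1)])
  also have "\<dots> = Y * A * Y" unfolding 1 by (rule assoc_mult_mat[OF Y(1) A Y(1), symmetric])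
  finally show ?thesis by (simp add: Y(3))
qed

lemma pseudoinverse_eqI: "is_pseudoinverse A X \<Longrightarrow> pseudoinverse A = X"
  unfolding pseudoinverse_def using is_pseudoinverse_unique by blast

text \<open>\<open>J\<close> is an eigenmatrix of \<open>M\<close>, hence also of \<open>V\<close>,
  and \<open>J * J\<close> is \<open>n\<close> times \<open>J\<close>. So \<open>M\<close> and
  \<open>M - J\<close> have the same product with \<open>X = V - J / n^2\<close>, namely the
  symmetric projection \<open>I - J / n\<close>, from which the Penrose conditions follow. The
  second claim later yields vanishing column sums.\<close>

lemma pseudoinverse_minus_all_ones:
  fixes M V :: "real mat" and n :: nat
  defines "J \<equiv> mat n n (\<lambda>_. 1)"
  assumes n: "n > 0" and M: "M \<in> carrier_mat n n" and V: "V \<in> carrier_mat n n"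
    and MV: "M * V = 1\<^sub>m n" and VM: "V * M = 1\<^sub>m n"
    and MJ: "M * J = real n \<cdot>\<^sub>m J" and JM: "J * M = real n \<cdot>\<^sub>m J"
  shows "pseudoinverse (M - J) = V - (1 / (real n)\<^sup>2) \<cdot>\<^sub>m J"
    and "J * (V - (1 / (real n)\<^sup>2) \<cdot>\<^sub>m J) = 0\<^sub>m n n"
proof -
  have J: "J \<in> carrier_mat n n" by (simp add: J_def)
  note carr = M V J
  have JJ: "J * J = real n \<cdot>\<^sub>m J" by (rule eq_matI) (auto simp: J_def scalar_prod_def)
  have smult: "c \<cdot>\<^sub>m (d \<cdot>\<^sub>m X) = (c * d) \<cdot>\<^sub>m X" for c d and X :: "real mat"
    by (rule eq_matI) auto
  have one: "1 \<cdot>\<^sub>m X = X" for X :: "real mat" by (rule eq_matI) auto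
  let ?c = "1 / (real n)\<^sup>2"
  have VJ: "V * J = (1 / real n) \<cdot>\<^sub>m J"
  proof -
    have "J = V * (M * J)" using VM J by (simp add: assoc_mult_mat[OF V M J, symmetric])
    also have "\<dots> = real n \<cdot>\<^sub>m (V * J)" unfolding MJ by (rule mult_smult_distrib[OF V J])
    finally have "(1 / real n) \<cdot>\<^sub>m J = (1 / real n) \<cdot>\<^sub>m (real n \<cdot>\<^sub>m (V * J))" by (rule arg_cong)
    then show ?thesis using n by (simp add: smult one)
  qed
  have JV: "J * V = (1 / real n) \<cdot>\<^sub>m J"
  proof -
    have "J = J * M * V" using MV J by (simp add: assoc_mult_mat[OF J M V])
    also have "\<dots> = real n \<cdot>\<^sub>m (J * V)" unfolding JM by (rule mult_smult_assoc_mat[OF J V])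
    finally have "(1 / real n) \<cdot>\<^sub>m J = (1 / real n) \<cdot>\<^sub>m (real n \<cdot>\<^sub>m (J * V))" by (rule arg_cong)
    then show ?thesis using n by (simp add: smult one)
  qed
  define X where "X = V - ?c \<cdot>\<^sub>m J"
  have X: "X \<in> carrier_mat n n" using V J minus_carrier_mat by (auto simp: X_def)
  have L: "M - J \<in> carrier_mat n n" using M J minus_carrier_mat by auto
  \<comment> \<open>The orthogonal projection onto the complement of the all-ones vector; it turns
    out to be both products of \<open>M - J\<close> with \<open>X\<close>.\<close>
  define K where "K = 1\<^sub>m n - (1 / real n) \<cdot>\<^sub>m J"
  have K: "K \<in> carrier_mat n n" using J minus_carrier_mat by (auto simp: K_def)
  have cJ: "?c \<cdot>\<^sub>m J \<in> carrier_mat n n" using J by simp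
  \<comment> \<open>This explains the constant \<open>1 / n^2\<close>: multiplying
    \<open>J / n^2\<close> by \<open>J\<close> gives \<open>J / n\<close>, which cancels
    \<open>J * V\<close>.\<close>
  have scale: "?c * real n = 1 / real n" using n by (simp add: power2_eq_square)
  have JX: "J * X = 0\<^sub>m n n"
    unfolding X_def mult_minus_distrib_mat[OF J V cJ] mult_smult_distrib[OF J J] JV JJ smult scale
    using J by (intro eq_matI) auto
  then show "J * (V - ?c \<cdot>\<^sub>m J) = 0\<^sub>m n n" by (simp add: X_def)
  have XJ: "X * J = 0\<^sub>m n n"
    unfolding X_def minus_mult_distrib_mat[OF V cJ J] mult_smult_assoc_mat[OF J J] VJ JJ smult scale
    using J by (intro eq_matI) auto
  have MX: "M * X = K"
    unfolding X_def K_def mult_minus_distrib_mat[OF M V cJ] mult_smult_distrib[OF M J] MV MJ smult scale ..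
  have XM: "X * M = K"
    unfolding X_def K_def minus_mult_distrib_mat[OF V cJ M] mult_smult_assoc_mat[OF J M] VM JM smult scale ..
  have LX: "(M - J) * X = K"
    unfolding minus_mult_distrib_mat[OF M J X] MX JX using K by (intro eq_matI) auto
  have XL: "X * (M - J) = K"
    unfolding mult_minus_distrib_mat[OF X M J] XM XJ using K by (intro eq_matI) auto
  have J1: "(1 / real n) \<cdot>\<^sub>m J \<in> carrier_mat n n" using J by simp
  have JL: "J * (M - J) = 0\<^sub>m n n"
    unfolding mult_minus_distrib_mat[OF J M J] JM JJ using J by (intro eq_matI) auto
  have KL: "K * (M - J) = M - J"
    unfolding K_def minus_mult_distrib_mat[OF one_carrier_mat J1 L] mult_smult_assoc_mat[OF J L] JL left_mult_one_mat[OF L]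
    using M J by (intro eq_matI) auto
  have KX: "K * X = X"
    unfolding K_def minus_mult_distrib_mat[OF one_carrier_mat J1 X] mult_smult_assoc_mat[OF J X] JX left_mult_one_mat[OF X]
    using X by (intro eq_matI) auto
  have "transpose_mat K = K" by (rule eq_matI) (auto simp: K_def J_def)
  then have "is_pseudoinverse (M - J) X"
    unfolding is_pseudoinverse_def using X L M J LX XL KL KX by simp
  then show "pseudoinverse (M - J) = V - ?c \<cdot>\<^sub>m J" unfolding X_def by (rule pseudoinverse_eqI)
qed

section \<open>Exchanging the factors in \<open>B * C\<close> and \<open>C * B\<close>\<close>

text \<open>The push-through identity \<open>?M * B = B * ?N\<close> turns
  \<open>?M * (B * W * C)\<close> into \<open>B * C\<close>, exactly what \<open>?M\<close> lacks to
  be \<open>c I\<close>.\<close>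

lemma woodbury_smult_one:
  fixes B C W :: "'a :: field mat"
  assumes B: "B \<in> carrier_mat n p" and C: "C \<in> carrier_mat p n" and W: "W \<in> carrier_mat p p"
    and c: "c \<noteq> 0" and inv: "(c \<cdot>\<^sub>m 1\<^sub>m p - C * B) * W = 1\<^sub>m p"
  shows "(c \<cdot>\<^sub>m 1\<^sub>m n - B * C) * ((1 / c) \<cdot>\<^sub>m (1\<^sub>m n + B * W * C)) = 1\<^sub>m n"
proof -
  let ?M = "c \<cdot>\<^sub>m 1\<^sub>m n - B * C" and ?N = "c \<cdot>\<^sub>m 1\<^sub>m p - C * B"
  have BC: "B * C \<in> carrier_mat n n" and CB: "C * B \<in> carrier_mat p p"
    and BW: "B * W \<in> carrier_mat n p" and BWC: "B * W * C \<in> carrier_mat n n" using B C W by auto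
  have M: "?M \<in> carrier_mat n n" and N: "?N \<in> carrier_mat p p"
    using minus_carrier_mat[OF BC] minus_carrier_mat[OF CB] by auto
  have I: "c \<cdot>\<^sub>m 1\<^sub>m n \<in> carrier_mat n n" "c \<cdot>\<^sub>m 1\<^sub>m p \<in> carrier_mat p p" by auto
  have "?M * B = c \<cdot>\<^sub>m B - B * C * B"
    unfolding minus_mult_distrib_mat[OF I(1) BC B] mult_smult_assoc_mat[OF one_carrier_mat B]
      left_mult_one_mat[OF B] ..
  also have "\<dots> = B * ?N"
    unfolding mult_minus_distrib_mat[OF B I(2) CB] mult_smult_distrib[OF B one_carrier_mat]
      right_mult_one_mat[OF B] assoc_mult_mat[OF B C B] ..
  finally have MB: "?M * B = B * ?N" .
  have "?M * (B * W * C) = ?M * B * W * C"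
    using assoc_mult_mat[OF M BW C] assoc_mult_mat[OF M B W] by simp
  also have "\<dots> = B * (?N * W) * C" unfolding MB assoc_mult_mat[OF B N W] ..
  also have "\<dots> = B * C" unfolding inv right_mult_one_mat[OF B] ..
  finally have "?M * (1\<^sub>m n + B * W * C) = ?M + B * C"
    unfolding mult_add_distrib_mat[OF M one_carrier_mat BWC] right_mult_one_mat[OF M] by simp
  also have "\<dots> = c \<cdot>\<^sub>m 1\<^sub>m n" using B C by (intro eq_matI) auto
  finally have "?M * (1\<^sub>m n + B * W * C) = c \<cdot>\<^sub>m 1\<^sub>m n" .
  then have "?M * ((1 / c) \<cdot>\<^sub>m (1\<^sub>m n + B * W * C)) = (1 / c) \<cdot>\<^sub>m (c \<cdot>\<^sub>m 1\<^sub>m n)"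
    using mult_smult_distrib[OF M, of "1\<^sub>m n + B * W * C" n] BWC by simp
  also have "\<dots> = 1\<^sub>m n" using c by (intro eq_matI) auto
  finally show ?thesis .
qed

text \<open>If \<open>C B y = c y\<close>, then \<open>B y\<close> lies in the kernel of
  \<open>c I - B C\<close> and is zero, so \<open>c y = C B y = 0\<close>. This carries
  invertibility from the vertex side (size \<open>n\<close>) to the edge side (size
  \<open>p\<close>).\<close>

lemma kernel_swap_factors:
  fixes B C :: "'a :: field mat"
  assumes B: "B \<in> carrier_mat n p" and C: "C \<in> carrier_mat p n" and c: "c \<noteq> 0"
    and ker: "\<And>w. w \<in> carrier_vec n \<Longrightarrow> (c \<cdot>\<^sub>m 1\<^sub>m n - B * C) *\<^sub>v w = 0\<^sub>v n \<Longrightarrow> w = 0\<^sub>v n"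
    and y: "y \<in> carrier_vec p" and Ny: "(c \<cdot>\<^sub>m 1\<^sub>m p - C * B) *\<^sub>v y = 0\<^sub>v p"
  shows "y = 0\<^sub>v p"
proof -
  have BC: "B * C \<in> carrier_mat n n" and CB: "C * B \<in> carrier_mat p p" using B C by auto
  have I: "c \<cdot>\<^sub>m 1\<^sub>m n \<in> carrier_mat n n" "c \<cdot>\<^sub>m 1\<^sub>m p \<in> carrier_mat p p" by auto
  have scale: "(c \<cdot>\<^sub>m 1\<^sub>m k) *\<^sub>v z = c \<cdot>\<^sub>v z" if "z \<in> carrier_vec k" for k and z :: "'a vec"
    using that by (intro eq_vecI) (auto simp: scalar_prod_def sum.delta if_distrib if_distribR cong: if_cong)
  have By: "B *\<^sub>v y \<in> carrier_vec n" using B y by auto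
  have CBy: "C *\<^sub>v (B *\<^sub>v y) = c \<cdot>\<^sub>v y"
  proof -
    have "c \<cdot>\<^sub>v y - C *\<^sub>v (B *\<^sub>v y) = 0\<^sub>v p"
      using Ny unfolding minus_mult_distrib_mat_vec[OF I(2) CB y] scale[OF y] assoc_mult_mat_vec[OF C B y] .
    then have "(c \<cdot>\<^sub>v y - C *\<^sub>v (B *\<^sub>v y)) $ i = 0" if "i < p" for i using that by simp
    then show ?thesis using y C
      by (intro eq_vecI) (auto simp del: index_mult_mat_vec)
  qed
  have "(c \<cdot>\<^sub>m 1\<^sub>m n - B * C) *\<^sub>v (B *\<^sub>v y) = c \<cdot>\<^sub>v (B *\<^sub>v y) - B *\<^sub>v (C *\<^sub>v (B *\<^sub>v y))"
    unfolding minus_mult_distrib_mat_vec[OF I(1) BC By] scale[OF By] assoc_mult_mat_vec[OF B C By] ..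
  also have "\<dots> = 0\<^sub>v n"
    unfolding CBy mult_mat_vec[OF B y] using By by auto
  finally have "B *\<^sub>v y = 0\<^sub>v n" by (rule ker[OF By])
  moreover have "C *\<^sub>v 0\<^sub>v n = 0\<^sub>v p" using C by auto
  ultimately have "c \<cdot>\<^sub>v y = 0\<^sub>v p" using CBy by simp
  then have "(c \<cdot>\<^sub>v y) $ i = 0" if "i < p" for i using that by simp
  then show ?thesis using c y by (intro eq_vecI) auto
qed

section \<open>Graph Laplacians and connectedness\<close>

text \<open>An edge through \<open>x\<close> is determined by its other endpoint. Degrees thereby
  become neighbour counts, which match the rows of the adjacency matrix.\<close>

lemma card_incident_edges:
  assumes "E \<subseteq> complete_edges n"
  shows "card {e \<in> E. x \<in> e} = card {y. y < n \<and> y \<noteq> x \<and> {x, y} \<in> E}"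
proof -
  have "bij_betw (\<lambda>y. {x, y}) {y. y < n \<and> y \<noteq> x \<and> {x, y} \<in> E} {e \<in> E. x \<in> e}"
    unfolding bij_betw_def
  proof
    show "inj_on (\<lambda>y. {x, y}) {y. y < n \<and> y \<noteq> x \<and> {x, y} \<in> E}"
      by (auto simp: inj_on_def doubleton_eq_iff)
    show "(\<lambda>y. {x, y}) ` {y. y < n \<and> y \<noteq> x \<and> {x, y} \<in> E} = {e \<in> E. x \<in> e}"
    proof (intro equalityI subsetI)
      fix e assume e: "e \<in> {e \<in> E. x \<in> e}"
      then obtain a b where "e = {a, b}" "a < n" "b < n" "a \<noteq> b"
        using assms by (auto simp: complete_edges_def)
      with e show "e \<in> (\<lambda>y. {x, y}) ` {y. y < n \<and> y \<noteq> x \<and> {x, y} \<in> E}"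
        by (auto simp: image_iff insert_commute)
    qed auto
  qed
  then show ?thesis by (rule bij_betw_same_card[symmetric])
qed

text \<open>The degree term supplies one copy of \<open>w $ x\<close> for each neighbour; this
  difference form is what the maximum principle needs.\<close>

lemma laplacian_mult_vec_index:
  assumes E: "E \<subseteq> complete_edges n" and w: "w \<in> carrier_vec n" and x: "x < n"
  shows "(laplacian n E *\<^sub>v w) $ x = (\<Sum>y | y < n \<and> y \<noteq> x \<and> {x, y} \<in> E. w $ x - w $ y)"
proof -
  let ?N = "{y. y < n \<and> y \<noteq> x \<and> {x, y} \<in> E}"
  have "(laplacian n E *\<^sub>v w) $ x
      = (\<Sum>y<n. (if y = x then real (card ?N) * w $ x else 0) - (if y \<in> ?N then w $ y else 0))"
    using w x unfolding laplacian_def degree_mat_def adjacency_mat_def card_incident_edges[OF E]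
    by (auto simp: scalar_prod_def lessThan_atLeast0 intro!: sum.cong)
  also have "\<dots> = real (card ?N) * w $ x - (\<Sum>y\<in>?N. w $ y)"
    using x by (simp add: sum_subtractf sum.inter_filter[symmetric] lessThan_def)
  also have "\<dots> = (\<Sum>y\<in>?N. w $ x - w $ y)" by (simp add: sum_subtractf)
  finally show ?thesis .
qed

text \<open>Maximum principle: at a vertex where \<open>w\<close> is maximal all summands \<open>w x - w y\<close> are nonnegative
  and sum to \<open>0\<close>, so the set of maximal vertices is closed under adjacency.\<close>

lemma laplacian_kernel_constant:
  assumes E: "E \<subseteq> complete_edges n" and conn: "graph_connected n E"
    and w: "w \<in> carrier_vec n" and ker: "laplacian n E *\<^sub>v w = 0\<^sub>v n"
    and x: "x < n" and y: "y < n"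
  shows "w $ x = w $ y"
proof -
  have img: "finite ((\<lambda>b. w $ b) ` {..<n})" "(\<lambda>b. w $ b) ` {..<n} \<noteq> {}" using x by auto
  obtain a where a: "a < n" and a_max: "w $ a = Max ((\<lambda>b. w $ b) ` {..<n})"
    using Max_in[OF img] by (metis (no_types, lifting) image_iff lessThan_iff)
  have max: "w $ b \<le> w $ a" if "b < n" for b
    unfolding a_max using that by (intro Max_ge) auto
  have "w $ b = w $ a" if "b < n" for b
  proof -
    have "(a, b) \<in> {(a, b). {a, b} \<in> E}\<^sup>*" using conn a that by (auto simp: graph_connected_def)
    \<comment> \<open>The bound \<open>b < n\<close> is carried along because the difference form is
      applied at every intermediate vertex of the path.\<close>
    then have "b < n \<and> w $ b = w $ a"
    proof (induction rule: rtrancl_induct)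
      case base
      then show ?case using a by simp
    next
      case (step c d)
      then have c: "c < n" "w $ c = w $ a" and cd: "{c, d} \<in> E" by auto
      have d: "d < n" "d \<noteq> c"
        using cd E by (auto simp: complete_edges_def doubleton_eq_iff)
      have "(\<Sum>y | y < n \<and> y \<noteq> c \<and> {c, y} \<in> E. w $ c - w $ y) = 0"
        using laplacian_mult_vec_index[OF E w c(1)] ker c(1) by simp
      then have "\<forall>y\<in>{y. y < n \<and> y \<noteq> c \<and> {c, y} \<in> E}. w $ c - w $ y = 0"
        by (subst (asm) sum_nonneg_eq_0_iff) (auto simp: c(2) max)
      then show ?case using d cd c by auto
    qed
    then show ?thesis by simp
  qed
  then show ?thesis using x y by metis
qed

section \<open>The incidence matrix and the complementary Laplacian\<close>

lemma oriented_incidence_mat_carrier [simp]: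
  "oriented_incidence_mat n p u v \<in> carrier_mat n p"
  by (simp add: oriented_incidence_mat_def mat_of_cols_def)

lemma oriented_incidence_mat_index:
  assumes "x < n" "\<alpha> < p"
  shows "oriented_incidence_mat n p u v $$ (x, \<alpha>)
    = (if x = u \<alpha> then 1 else 0) - (if x = v \<alpha> then 1 else 0)"
  using assms by (simp add: oriented_incidence_mat_def mat_of_cols_index unit_vec_def)

lemma complete_edges_doubleton:
  "{a, b} \<in> complete_edges n \<longleftrightarrow> a < n \<and> b < n \<and> a \<noteq> b"
  by (auto simp: complete_edges_def doubleton_eq_iff)

text \<open>Each column contributes the Laplacian of a single edge. Reversing an orientation flips
  both signs in a product of two entries, so the contribution depends only on the unordered edge and
  the sum can be taken over \<open>F\<close>.\<close>

lemma incidence_mult_transpose: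
  assumes F: "F \<subseteq> complete_edges n" and bij: "bij_betw (\<lambda>\<alpha>. {u \<alpha>, v \<alpha>}) {..<p} F"
  shows "oriented_incidence_mat n p u v * transpose_mat (oriented_incidence_mat n p u v)
    = laplacian n F" (is "?B * _ = _")
proof (rule eq_matI)
  fix x y assume "x < dim_row (laplacian n F)" "y < dim_col (laplacian n F)"
  then have x: "x < n" and y: "y < n" by (auto simp: laplacian_def adjacency_mat_def)
  have fin: "finite F" using bij bij_betw_finite by blast
  have ne: "u \<alpha> \<noteq> v \<alpha>" if "\<alpha> < p" for \<alpha>
    using bij_betwE[OF bij] F that complete_edges_doubleton by blast
  \<comment> \<open>The \<open>(x, y)\<close> entry of the Laplacian of the single edge
    \<open>e\<close>.\<close>
  define g :: "nat set \<Rightarrow> real"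
    where "g e = (if x = y then if x \<in> e then 1 else 0 else if {x, y} = e then -1 else 0)" for e
  have "(?B * transpose_mat ?B) $$ (x, y) = (\<Sum>\<alpha><p. ?B $$ (x, \<alpha>) * ?B $$ (y, \<alpha>))"
    using x y carrier_matD[OF oriented_incidence_mat_carrier[of n p u v]]
    by (simp add: scalar_prod_def lessThan_atLeast0)
  also have "\<dots> = (\<Sum>\<alpha><p. g {u \<alpha>, v \<alpha>})"
  proof (intro sum.cong refl)
    fix \<alpha> assume "\<alpha> \<in> {..<p}"
    then show "?B $$ (x, \<alpha>) * ?B $$ (y, \<alpha>) = g {u \<alpha>, v \<alpha>}"
      using x y ne[of \<alpha>] by (auto simp: oriented_incidence_mat_index g_def doubleton_eq_iff)
  qed
  also have "\<dots> = (\<Sum>e\<in>F. g e)" by (rule sum.reindex_bij_betw[OF bij])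
  also have "\<dots> = laplacian n F $$ (x, y)"
  proof (cases "x = y")
    case True
    then show ?thesis using x fin
      by (simp add: g_def laplacian_def degree_mat_def adjacency_mat_def sum.inter_filter[symmetric])
  next
    case False
    then show ?thesis using x y fin
      by (simp add: g_def laplacian_def degree_mat_def adjacency_mat_def)
  qed
  finally show "(?B * transpose_mat ?B) $$ (x, y) = laplacian n F $$ (x, y)" .
qed (simp_all add: laplacian_def adjacency_mat_def carrier_matD[OF oriented_incidence_mat_carrier])

text \<open>The Laplacian of the complete graph is \<open>n I - J\<close>, and Laplacians add over
  disjoint edge sets. On the diagonal this is the count that the degrees in \<open>F\<close> and in
  its complement sum to \<open>n - 1\<close>.\<close>

lemma laplacian_complement:
  assumes F: "F \<subseteq> complete_edges n"
  shows "laplacian n (complete_edges n - F) = real n \<cdot>\<^sub>m 1\<^sub>m n - laplacian n F - mat n n (\<lambda>_. 1)"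
proof (rule eq_matI)
  fix x y assume "x < dim_row (real n \<cdot>\<^sub>m 1\<^sub>m n - laplacian n F - mat n n (\<lambda>_. 1))"
    "y < dim_col (real n \<cdot>\<^sub>m 1\<^sub>m n - laplacian n F - mat n n (\<lambda>_. 1))"
  then have x: "x < n" and y: "y < n" by auto
  let ?K = "{y. y < n \<and> y \<noteq> x}" and ?N = "{y. y < n \<and> y \<noteq> x \<and> {x, y} \<in> F}"
  have "{y. y < n \<and> y \<noteq> x \<and> {x, y} \<in> complete_edges n - F} = ?K - ?N"
    using x by (auto simp: complete_edges_doubleton)
  \<comment> \<open>The inequality keeps the natural-number subtraction from truncating.\<close>
  moreover have "card (?K - ?N) = card ?K - card ?N" "card ?N \<le> card ?K"
    by (auto intro!: card_Diff_subset card_mono)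
  moreover have "card ?K = n - 1"
  proof -
    have "?K = {..<n} - {x}" by auto
    then show ?thesis using x by simp
  qed
  ultimately have "real (card {e \<in> complete_edges n - F. x \<in> e})
      = real n - 1 - real (card {e \<in> F. x \<in> e})"
    unfolding card_incident_edges[OF F] card_incident_edges[OF Diff_subset]
    using x by (simp add: of_nat_diff)
  then show "laplacian n (complete_edges n - F) $$ (x, y)
      = (real n \<cdot>\<^sub>m 1\<^sub>m n - laplacian n F - mat n n (\<lambda>_. 1)) $$ (x, y)"
    using x y by (auto simp: laplacian_def degree_mat_def adjacency_mat_def complete_edges_doubleton)
qed (auto simp: laplacian_def degree_mat_def adjacency_mat_def)

section \<open>The Kirchhoff index as a trace\<close>

lemma sum_pairs_less_double:
  fixes f :: "nat \<Rightarrow> nat \<Rightarrow> real"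
  assumes "\<And>x y. f x y = f y x" "\<And>x. f x x = 0"
  shows "2 * (\<Sum>(x, y) | x < y \<and> y < n. f x y) = (\<Sum>x<n. \<Sum>y<n. f x y)"
proof -
  have "(\<Sum>(x, y) | x < y \<and> y < n. f x y) = (\<Sum>(y, x)\<in>(SIGMA y:{..<n}. {..<y}). f x y)"
    by (rule sum.reindex_bij_witness[of _ prod.swap prod.swap]) auto
  also have "\<dots> = (\<Sum>y<n. \<Sum>x<y. f x y)" by (simp add: sum.Sigma)
  finally have "(\<Sum>(x, y) | x < y \<and> y < n. f x y) = (\<Sum>y<n. \<Sum>x<y. f x y)" .
  moreover have "2 * (\<Sum>y<n. \<Sum>x<y. f x y) = (\<Sum>x<n. \<Sum>y<n. f x y)"
    \<comment> \<open>Passing from \<open>n\<close> to \<open>n + 1\<close> adds row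
      \<open>n\<close> and column \<open>n\<close>, equal by symmetry, and the corner
      \<open>f n n\<close>, which is 0.\<close>
    by (induction n) (simp_all add: sum.distrib assms(2) assms(1)[of _ "Suc _"] algebra_simps, metis assms(1))
  ultimately show ?thesis by simp
qed

lemma unit_vec_diff_quadratic_form:
  fixes X :: "real mat"
  assumes X: "X \<in> carrier_mat n n" and x: "x < n" and y: "y < n"
  shows "(unit_vec n x - unit_vec n y) \<bullet> (X *\<^sub>v (unit_vec n x - unit_vec n y))
    = X $$ (x, x) + X $$ (y, y) - X $$ (x, y) - X $$ (y, x)"
proof -
  have row: "row X i \<bullet> (unit_vec n x - unit_vec n y) = X $$ (i, x) - X $$ (i, y)" if "i < n" for i
    using X x y that by (subst scalar_prod_minus_distrib[of _ n]) auto
  have "X *\<^sub>v (unit_vec n x - unit_vec n y) = vec n (\<lambda>i. X $$ (i, x) - X $$ (i, y))"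
    using X row by (intro eq_vecI) auto
  then show ?thesis
    using x y by (subst minus_scalar_prod_distrib[of _ n]) auto
qed

text \<open>Over all ordered pairs the two diagonal terms of the resistance give \<open>2 n\<close>
  times the trace, while the off-diagonal terms give the sum of all entries of \<open>X\<close>,
  which vanishes column by column.\<close>

lemma kirchhoff_index_eq_trace:
  assumes L: "pseudoinverse (laplacian n E) = X" and X: "X \<in> carrier_mat n n"
    and col: "\<And>y. y < n \<Longrightarrow> (\<Sum>x<n. X $$ (x, y)) = 0"
  shows "kirchhoff_index n E = real n * trace_mat X"
proof -
  define f where "f x y = X $$ (x, x) + X $$ (y, y) - X $$ (x, y) - X $$ (y, x)" for x y
  have "kirchhoff_index n E = (\<Sum>(x, y) | x < y \<and> y < n. f x y)"
    unfolding kirchhoff_index_def effective_resistance_def L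
    by (intro sum.cong refl) (auto simp: unit_vec_diff_quadratic_form[OF X] f_def)
  then have "2 * kirchhoff_index n E = (\<Sum>x<n. \<Sum>y<n. f x y)"
    by (simp add: sum_pairs_less_double f_def)
  also have "\<dots> = 2 * real n * trace_mat X
      - (\<Sum>x<n. \<Sum>y<n. X $$ (x, y)) - (\<Sum>x<n. \<Sum>y<n. X $$ (y, x))"
    by (simp add: f_def sum.distrib sum_subtractf trace_mat_eq_sum[OF X] sum_distrib_left[symmetric])
  also have "(\<Sum>x<n. \<Sum>y<n. X $$ (x, y)) = (\<Sum>x<n. \<Sum>y<n. X $$ (y, x))" by (rule sum.swap)
  also have "(\<Sum>x<n. \<Sum>y<n. X $$ (y, x)) = 0" using col by simp
  finally show ?thesis by simp
qed

section \<open>Combining the formulas\<close>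

text \<open>With \<open>?D = (c - a) I - ?N\<close>, each multiplication by \<open>?D\<close> trades
  \<open>?N * W\<close> for the identity, so only the traces of \<open>W\<close>, \<open>Q\<close>
  and \<open>I\<close> remain. It is applied with \<open>c = n\<close> and
  \<open>a = 2\<close>.\<close>

lemma trace_shifted_square_inverse:
  fixes Q W :: "real mat"
  assumes Q: "Q \<in> carrier_mat p p" and W: "W \<in> carrier_mat p p"
    and inv: "(c \<cdot>\<^sub>m 1\<^sub>m p - Q) * W = 1\<^sub>m p"
  shows "trace_mat ((Q - a \<cdot>\<^sub>m 1\<^sub>m p) ^\<^sub>m 2 * W)
    = (c - a)\<^sup>2 * trace_mat W - (c - 2 * a) * real p - trace_mat Q"
proof -
  let ?D = "Q - a \<cdot>\<^sub>m 1\<^sub>m p" and ?N = "c \<cdot>\<^sub>m 1\<^sub>m p - Q"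
  have I: "d \<cdot>\<^sub>m 1\<^sub>m p \<in> carrier_mat p p" for d :: real by simp
  have D: "?D \<in> carrier_mat p p" and N: "?N \<in> carrier_mat p p"
    using minus_carrier_mat[OF I] minus_carrier_mat[OF Q] by auto
  have dW: "d \<cdot>\<^sub>m W \<in> carrier_mat p p" for d using W by simp
  have "?D = (c - a) \<cdot>\<^sub>m 1\<^sub>m p - ?N" using Q by (intro eq_matI) (auto simp: algebra_simps)
  then have DW: "?D * W = (c - a) \<cdot>\<^sub>m W - 1\<^sub>m p"
    using minus_mult_distrib_mat[OF I N W] mult_smult_assoc_mat[OF one_carrier_mat W] W inv by simp
  have DWc: "?D * W \<in> carrier_mat p p" using D W by simp
  have "?D ^\<^sub>m 2 = ?D * ?D" using left_mult_one_mat[OF D] carrier_matD[OF D] by (simp add: numeral_2_eq_2)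
  then have "?D ^\<^sub>m 2 * W = ?D * (?D * W)" using assoc_mult_mat[OF D D W] by simp
  also have "\<dots> = (c - a) \<cdot>\<^sub>m (?D * W) - ?D"
    using mult_minus_distrib_mat[OF D dW one_carrier_mat] mult_smult_distrib[OF D W]
      right_mult_one_mat[OF D] by (simp only: DW)
  finally have "trace_mat (?D ^\<^sub>m 2 * W) = (c - a) * trace_mat (?D * W) - trace_mat ?D"
    using DWc D by (simp add: trace_mat_minus[of _ p] trace_mat_smult[of _ p])
  also have "trace_mat (?D * W) = (c - a) * trace_mat W - real p"
    unfolding DW using W by (simp add: trace_mat_minus[of _ p] trace_mat_smult[of _ p] trace_mat_one)
  also have "trace_mat ?D = trace_mat Q - a * real p"
    using Q by (simp add: trace_mat_minus[of _ p] trace_mat_smult[of _ p] trace_mat_one)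
  finally show ?thesis by (simp add: power2_eq_square algebra_simps)
qed

text \<open>Isolates the intermediate formula in the trace of the inverse of \<open>N\<close>, from
  which both stated forms follow by algebra.\<close>

lemma edge_deleted_kirchhoff_index:
  assumes n: "n > 0" and F: "F \<subseteq> complete_edges n"
    and bij: "bij_betw (\<lambda>\<alpha>. {u \<alpha>, v \<alpha>}) {..<p} F"
    and conn: "graph_connected n (complete_edges n - F)"
    and Q_def: "Q = edge_defect_mat n p u v"
  defines "N \<equiv> real n \<cdot>\<^sub>m 1\<^sub>m p - Q"
  shows "Q \<in> carrier_mat p p" "trace_mat Q = 2 * real p"
    and "inv_mat N \<in> carrier_mat p p" "N * inv_mat N = 1\<^sub>m p" "inv_mat N * N = 1\<^sub>m p"
    and "kirchhoff_index n (complete_edges n - F) = real n - 1 - real p + real n * trace_mat (inv_mat N)"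
proof -
  define B where "B = oriented_incidence_mat n p u v"
  define C where "C = transpose_mat B"
  have B: "B \<in> carrier_mat n p" and C: "C \<in> carrier_mat p n" by (auto simp: B_def C_def)
  have Q_eq: "Q = C * B" by (simp add: Q_def edge_defect_mat_def C_def B_def)
  show Q: "Q \<in> carrier_mat p p" using B C by (simp add: Q_eq)
  have BC: "B * C = laplacian n F"
    using incidence_mult_transpose[OF F bij] by (simp add: B_def C_def)
  have BCc: "B * C \<in> carrier_mat n n" using B C by simp
  have edge: "u \<alpha> < n" "v \<alpha> < n" "u \<alpha> \<noteq> v \<alpha>" if "\<alpha> < p" for \<alpha>
    using bij_betwE[OF bij] F that complete_edges_doubleton by blast+
  have Bi: "B $$ (x, \<alpha>) = (if x = u \<alpha> then 1 else 0) - (if x = v \<alpha> then 1 else 0)"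
    if "x < n" "\<alpha> < p" for x \<alpha> using that by (simp add: B_def oriented_incidence_mat_index)
  have B_col: "(\<Sum>x<n. B $$ (x, \<alpha>)) = 0" if "\<alpha> < p" for \<alpha>
    using edge[OF that] that by (simp add: Bi sum_subtractf)
  have "Q $$ (\<alpha>, \<alpha>) = 2" if "\<alpha> < p" for \<alpha>
  proof -
    have "Q $$ (\<alpha>, \<alpha>) = (\<Sum>x<n. B $$ (x, \<alpha>) * B $$ (x, \<alpha>))"
      using B that by (simp add: Q_eq C_def scalar_prod_def lessThan_atLeast0)
    \<comment> \<open>Since \<open>u \<alpha>\<close> and \<open>v \<alpha>\<close> differ, the
      squared entries are two separate ones.\<close>
    also have "\<dots> = (\<Sum>x<n. (if x = u \<alpha> then 1 else 0) + (if x = v \<alpha> then 1 else 0))"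
      using edge[OF that] that by (intro sum.cong refl) (auto simp: Bi)
    finally show ?thesis using edge[OF that] by (simp add: sum.distrib)
  qed
  then show trQ: "trace_mat Q = 2 * real p" by (simp add: trace_mat_eq_sum[OF Q])
  define J :: "real mat" where "J = mat n n (\<lambda>_. 1)"
  define M where "M = real n \<cdot>\<^sub>m 1\<^sub>m n - B * C"
  have J: "J \<in> carrier_mat n n" by (simp add: J_def)
  have M: "M \<in> carrier_mat n n" unfolding M_def using BCc by (rule minus_carrier_mat)
  have I: "real n \<cdot>\<^sub>m 1\<^sub>m k \<in> carrier_mat k k" for k by simp
  \<comment> \<open>Every column of \<open>B\<close> sums to zero, and \<open>C\<close> is its
    transpose.\<close>
  have JB: "J * B = 0\<^sub>m n p" and CJ: "C * J = 0\<^sub>m p n"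
    using B by (auto intro!: eq_matI simp: J_def C_def scalar_prod_def B_col lessThan_atLeast0[symmetric])
  have JBC: "J * (B * C) = 0\<^sub>m n n" and BCJ: "B * C * J = 0\<^sub>m n n"
    using assoc_mult_mat[OF J B C] assoc_mult_mat[OF B C J] B C by (simp_all add: JB CJ)
  have MJ: "M * J = real n \<cdot>\<^sub>m J"
    unfolding M_def minus_mult_distrib_mat[OF I BCc J] BCJ mult_smult_assoc_mat[OF one_carrier_mat J]
    using J by (intro eq_matI) auto
  have JM: "J * M = real n \<cdot>\<^sub>m J"
    unfolding M_def mult_minus_distrib_mat[OF J I BCc] JBC mult_smult_distrib[OF J one_carrier_mat]
    using J by (intro eq_matI) auto
  have L: "laplacian n (complete_edges n - F) = M - J"
    using laplacian_complement[OF F] by (simp add: M_def J_def BC)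
  \<comment> \<open>Applying \<open>J\<close> to \<open>M w = 0\<close> shows that the entries of
    \<open>w\<close> sum to 0, so \<open>w\<close> is also in the kernel of the Laplacian
    \<open>M - J\<close>. Connectedness makes \<open>w\<close> constant, and a constant vector with
    zero sum is zero.\<close>
  have kerM: "w = 0\<^sub>v n" if w: "w \<in> carrier_vec n" and Mw: "M *\<^sub>v w = 0\<^sub>v n" for w
  proof -
    have Jw: "(J *\<^sub>v w) $ x = (\<Sum>y<n. w $ y)" if "x < n" for x
      using that w by (simp add: J_def scalar_prod_def lessThan_atLeast0)
    have "real n \<cdot>\<^sub>m J *\<^sub>v w = J *\<^sub>v (M *\<^sub>v w)"
      unfolding JM[symmetric] by (rule assoc_mult_mat_vec[OF J M w])
    also have "\<dots> = 0\<^sub>v n" unfolding Mw using J by (intro eq_vecI) (auto simp: scalar_prod_def)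
    finally have "(real n \<cdot>\<^sub>m J *\<^sub>v w) $ 0 = 0" using n by simp
    moreover have "(real n \<cdot>\<^sub>m J *\<^sub>v w) $ 0 = real n * (\<Sum>y<n. w $ y)"
      using n w by (simp add: J_def scalar_prod_def lessThan_atLeast0 sum_distrib_left)
    ultimately have s0: "(\<Sum>y<n. w $ y) = 0" using n by simp
    have "(M - J) *\<^sub>v w = 0\<^sub>v n"
      unfolding minus_mult_distrib_mat_vec[OF M J w] Mw
      using Jw s0 J by (intro eq_vecI) (auto simp del: index_mult_mat_vec)
    then have const: "w $ x = w $ y" if "x < n" "y < n" for x y
      using laplacian_kernel_constant[OF Diff_subset conn w _ that] by (simp add: L)
    have "(\<Sum>y<n. w $ y) = real n * w $ x" if "x < n" for x
      using const[OF _ that] by simp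
    then show ?thesis using s0 n w by (intro eq_vecI) auto
  qed
  have "N \<in> carrier_mat p p" unfolding N_def using Q by (rule minus_carrier_mat)
  moreover have "y = 0\<^sub>v p" if "y \<in> carrier_vec p" "N *\<^sub>v y = 0\<^sub>v p" for y
    using kernel_swap_factors[OF B C, of "real n" y] n that kerM by (simp add: M_def N_def Q_eq)
  ultimately show W: "inv_mat N \<in> carrier_mat p p" and NW: "N * inv_mat N = 1\<^sub>m p"
    and "inv_mat N * N = 1\<^sub>m p"
    using inv_mat_of_trivial_kernel by blast+
  define W where "W = inv_mat N"
  note W = W[folded W_def] and NW = NW[folded W_def]
  have BW: "B * W \<in> carrier_mat n p" and BWC: "B * W * C \<in> carrier_mat n n" using B C W by auto
  define V where "V = (1 / real n) \<cdot>\<^sub>m (1\<^sub>m n + B * W * C)"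
  have V: "V \<in> carrier_mat n n" using BWC by (simp add: V_def)
  have MV: "M * V = 1\<^sub>m n"
    using woodbury_smult_one[OF B C W, of "real n"] n NW by (simp add: M_def V_def N_def Q_eq)
  have VM: "V * M = 1\<^sub>m n" by (rule mat_mult_left_right_inverse[OF M V MV])
  define X where "X = V - (1 / (real n)\<^sup>2) \<cdot>\<^sub>m J"
  have cJ: "(1 / (real n)\<^sup>2) \<cdot>\<^sub>m J \<in> carrier_mat n n" using J by simp
  have X: "X \<in> carrier_mat n n" unfolding X_def using cJ by (rule minus_carrier_mat)
  note pinv = pseudoinverse_minus_all_ones[OF n M V MV VM MJ[unfolded J_def] JM[unfolded J_def],
      folded J_def, folded X_def]
  have "(\<Sum>x<n. X $$ (x, y)) = 0" if "y < n" for y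
  proof -
    have "(J * X) $$ (y, y) = (\<Sum>x<n. X $$ (x, y))"
      using X that by (simp add: J_def scalar_prod_def lessThan_atLeast0)
    then show ?thesis using that by (simp add: pinv(2))
  qed
  with pinv(1) X have "kirchhoff_index n (complete_edges n - F) = real n * trace_mat X"
    by (intro kirchhoff_index_eq_trace) (simp_all add: L)
  also have "trace_mat X = trace_mat V - 1 / real n"
  proof -
    have "trace_mat J = real n" by (simp add: trace_mat_eq_sum[OF J]) (simp add: J_def)
    then show ?thesis
      unfolding X_def trace_mat_minus[OF V cJ] trace_mat_smult[OF J] by (simp add: power2_eq_square)
  qed
  also have "trace_mat V = (1 / real n) * (real n + trace_mat (B * W * C))"
    unfolding V_def using BWC
    by (simp add: trace_mat_smult[of _ n] trace_mat_add[of _ n] trace_mat_one)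
  \<comment> \<open>Cyclicity moves the trace to \<open>Q * W\<close>, and \<open>N * W = I\<close>
    says that \<open>Q * W = n W - I\<close>.\<close>
  also have "trace_mat (B * W * C) = real n * trace_mat W - real p"
  proof -
    have "trace_mat (B * W * C) = trace_mat (Q * W)"
      unfolding trace_mat_mult_comm[OF BW C] Q_eq assoc_mult_mat[OF C B W] ..
    moreover have "real n \<cdot>\<^sub>m W - Q * W = 1\<^sub>m p"
      using NW unfolding N_def minus_mult_distrib_mat[OF I Q W] mult_smult_assoc_mat[OF one_carrier_mat W]
        left_mult_one_mat[OF W] .
    then have "trace_mat (real n \<cdot>\<^sub>m W) - trace_mat (Q * W) = trace_mat (1\<^sub>m p)"
      using W Q by (simp add: trace_mat_minus[of _ p, symmetric])
    ultimately show ?thesis using trace_mat_smult[OF W] by (simp add: trace_mat_one)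
  qed
  finally show "kirchhoff_index n (complete_edges n - F)
      = real n - 1 - real p + real n * trace_mat (inv_mat N)"
    using n by (simp add: W_def right_diff_distrib distrib_left)
qed

theorem theorem5p1:
  fixes n p :: nat and F :: "nat set set" and u v :: "nat \<Rightarrow> nat" and Q :: "real mat"
  assumes "n \<ge> 3"
    and "p \<ge> 1"
    and "F \<subseteq> complete_edges n"
    and "bij_betw (\<lambda>\<alpha>. {u \<alpha>, v \<alpha>}) {..<p} F"
    and "graph_connected n (complete_edges n - F)"
    and "Q = edge_defect_mat n p u v"
  shows "invertible_mat (real n \<cdot>\<^sub>m 1\<^sub>m p - Q) \<and>
    kirchhoff_index n (complete_edges n - F) =
      real n - 1 + 2 * real p / (real n - 2) +
      real n / (real n - 2)\<^sup>2 *
        trace_mat ((Q - 2 \<cdot>\<^sub>m 1\<^sub>m p) ^\<^sub>m 2 * inv_mat (real n \<cdot>\<^sub>m 1\<^sub>m p - Q)) \<and>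
    (\<forall>\<theta>. eigenvalues_of Q \<theta> \<longrightarrow>
      (\<forall>\<alpha><p. \<theta> \<alpha> \<noteq> real n) \<and>
      kirchhoff_index n (complete_edges n - F) =
        real n - 1 + 2 * real p / (real n - 2) +
        real n / (real n - 2)\<^sup>2 * (\<Sum>\<alpha><p. (\<theta> \<alpha> - 2)\<^sup>2 / (real n - \<theta> \<alpha>)))"
proof -
  let ?N = "real n \<cdot>\<^sub>m 1\<^sub>m p - Q"
  define W where "W = inv_mat ?N"
  define d where "d = real n - 2"
  define Kf where "Kf = kirchhoff_index n (complete_edges n - F)"
  have "n > 0" using assms(1) by simp
  note facts = edge_deleted_kirchhoff_index[OF this assms(3-6), folded W_def]
  note Q = facts(1) and trQ = facts(2) and W = facts(3) and NW = facts(4) and WN = facts(5)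
    and Kf = facts(6)[folded Kf_def]
  have d: "d \<noteq> 0" "real n = d + 2" using assms(1) by (auto simp: d_def)
  \<comment> \<open>Both forms reduce to this value of \<open>t\<close>: it contributes
    \<open>n tr W - n p / d\<close>, and \<open>2 p / d - n p / d = - p\<close> because
    \<open>n = d + 2\<close>.\<close>
  have Kf_eq: "Kf = real n - 1 + 2 * real p / d + real n / d\<^sup>2 * t"
    if "t = d\<^sup>2 * trace_mat W - d * real p" for t
    unfolding Kf that using d(1) by (simp add: d(2) field_simps power2_eq_square)
  have N: "?N \<in> carrier_mat p p" using Q by (rule minus_carrier_mat)
  have "invertible_mat ?N"
    using N W NW WN unfolding invertible_mat_def inverts_mat_def square_mat.simps
    by (metis carrier_matD)
  moreover have "Kf = real n - 1 + 2 * real p / d + real n / d\<^sup>2 * trace_mat ((Q - 2 \<cdot>\<^sub>m 1\<^sub>m p) ^\<^sub>m 2 * W)"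
    \<comment> \<open>Here \<open>c - 2 a = d - 2\<close>, and the trace \<open>2 p\<close> of
      \<open>Q\<close> completes \<open>(d - 2) p\<close> to \<open>d p\<close>.\<close>
    by (rule Kf_eq) (simp add: trace_shifted_square_inverse[OF Q W NW] trQ d(2) algebra_simps)
  moreover have "(\<forall>\<alpha><p. \<theta> \<alpha> \<noteq> real n) \<and>
      Kf = real n - 1 + 2 * real p / d + real n / d\<^sup>2 * (\<Sum>\<alpha><p. (\<theta> \<alpha> - 2)\<^sup>2 / (real n - \<theta> \<alpha>))"
    if \<theta>: "eigenvalues_of Q \<theta>" for \<theta>
  proof
    note eig = eigenvalues_of_trace[OF Q \<theta> W NW]
    show ne: "\<forall>\<alpha><p. \<theta> \<alpha> \<noteq> real n" using eig(2) by blast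
    \<comment> \<open>Division with remainder by \<open>n - \<theta> \<alpha>\<close>, based on the
      difference of squares \<open>d^2 - (\<theta> \<alpha> - 2)^2\<close> and
      \<open>n = d + 2\<close>.\<close>
    have "(\<theta> \<alpha> - 2)\<^sup>2 / (real n - \<theta> \<alpha>) = d\<^sup>2 * (1 / (real n - \<theta> \<alpha>)) - d - (\<theta> \<alpha> - 2)"
      if "\<alpha> < p" for \<alpha>
    proof -
      have "real n - \<theta> \<alpha> \<noteq> 0" using ne that by auto
      moreover have "(\<theta> \<alpha> - 2)\<^sup>2 = d\<^sup>2 - (d + \<theta> \<alpha> - 2) * (real n - \<theta> \<alpha>)"
        by (simp add: d(2) power2_eq_square algebra_simps)
      ultimately show ?thesis by (simp add: diff_divide_distrib)
    qed
    then have "(\<Sum>\<alpha><p. (\<theta> \<alpha> - 2)\<^sup>2 / (real n - \<theta> \<alpha>))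
        = (\<Sum>\<alpha><p. d\<^sup>2 * (1 / (real n - \<theta> \<alpha>)) - d - (\<theta> \<alpha> - 2))"
      by (intro sum.cong) auto
    \<comment> \<open>The last bracket is zero, since the eigenvalues sum to the trace
      \<open>2 p\<close>.\<close>
    also have "\<dots> = d\<^sup>2 * trace_mat W - d * real p - (trace_mat Q - 2 * real p)"
      unfolding eig(1,3) sum_distrib_left by (simp add: sum_subtractf)
    finally show "Kf = real n - 1 + 2 * real p / d
        + real n / d\<^sup>2 * (\<Sum>\<alpha><p. (\<theta> \<alpha> - 2)\<^sup>2 / (real n - \<theta> \<alpha>))"
      by (intro Kf_eq) (simp add: trQ)
  qed
  ultimately show ?thesis unfolding Kf_def W_def d_def by blast
qed

end
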